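(* Let $m\ge1$ and $n\ge0$ be integers and let $w$ be a permutation in $\mathfrak{S}_{m+n}$. The permutation $w$ is $m$-312 free if and only if $w$ is an $L_{m,n}$-permutation.
   Context: $\mathfrak{S}_{N}$ is the set of permutations of $[N]=\{1,\ldots,N\}$. $L_{m,n}$ is the graph on vertex set $[m+n]$ which is the complete graph on $\{1,\ldots,m\}$ together with the path $m,m+1,\ldots,m+n$ (edges $\{i,i+1\}$ for $m\le i<m+n$). A permutation $w\in\mathfrak{S}_{m+n}$ is $m$-312 free (or $m$-312 avoiding) if there do not exist integers $1\le i<j<k\le m+n$ such that $w(j)<w(k)<w(i)$ and $w(k)\ge m$. For a graph $G$ on $[N]$, a permutation $w\in\mathfrak{S}_N$ is a $G$-permutation if for all $i\in[N]$, $w(i)$ is in the same connected component as $\max\{w(1),\ldots,w(i)\}$ in the induced subgraph $G|_{\{w(1),\ldots,w(i)\}}$. (In the tubing lattice $\mathfrak{L}(G)$, for $G=L_{m,n}$, the elements are identified with the $G$-permutations.) *)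

theory Defs
  imports "HOL-Combinatorics.Permutations" "Graph_Theory.Graph_Theory"
begin

text \<open>
  A simple graph is a \<^locale>\<open>pair_graph\<close>: a finite loop-free symmetric digraph in which the
  edge $\{u,v\}$ is the pair of arcs $(u,v)$, $(v,u)$. The connected components of such a graph
  are its strongly connected components, whose vertex sets form
  \<^const>\<open>pre_digraph.sccs_verts\<close>.
\<close>

definition lollipop :: "nat \<Rightarrow> nat \<Rightarrow> nat pair_pre_digraph" where
  "lollipop m n =
     \<lparr> pverts = {1..m + n},
       parcs = {(i, j). i \<in> {1..m} \<and> j \<in> {1..m} \<and> i \<noteq> j}
             \<union> {(i, i + 1) | i. m \<le> i \<and> i < m + n}
             \<union> {(i + 1, i) | i. m \<le> i \<and> i < m + n} \<rparr>"

lemma pair_graph_lollipop: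
  assumes "m \<ge> 1"
  shows "pair_graph (lollipop m n)"
proof -
  have sub: "parcs (lollipop m n) \<subseteq> {1..m + n} \<times> {1..m + n}"
    using assms by (auto simp: lollipop_def)
  then have fin: "finite (parcs (lollipop m n))"
    by (rule finite_subset) simp
  show ?thesis
  proof
    show "symmetric (with_proj (lollipop m n))"
      by (auto simp: symmetric_def sym_def lollipop_def)
  qed (use sub fin in \<open>auto simp: lollipop_def\<close>)
qed

definition same_component :: "('a, 'b) pre_digraph \<Rightarrow> 'a \<Rightarrow> 'a \<Rightarrow> bool" where
  "same_component G u v \<longleftrightarrow> (\<exists>C \<in> pre_digraph.sccs_verts G. u \<in> C \<and> v \<in> C)"

text \<open>To be used for a \<^locale>\<open>pair_graph\<close> \<open>G\<close> with vertex set \<open>{1..N}\<close>.\<close>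

definition graph_permutation :: "nat pair_pre_digraph \<Rightarrow> (nat \<Rightarrow> nat) \<Rightarrow> bool" where
  "graph_permutation G w \<longleftrightarrow>
     w permutes pverts G \<and>
     (\<forall>i \<in> pverts G.
        same_component (with_proj G \<restriction> (w ` {1..i})) (w i) (Max (w ` {1..i})))"

definition m312_free :: "nat \<Rightarrow> nat \<Rightarrow> (nat \<Rightarrow> nat) \<Rightarrow> bool" where
  "m312_free m n w \<longleftrightarrow>
     \<not> (\<exists>i j k. 1 \<le> i \<and> i < j \<and> j < k \<and> k \<le> m + n \<and>
           w j < w k \<and> w k < w i \<and> w k \<ge> m)"

end

theory Submission
  imports Defs
begin

text \<open>
  Fix a vertex set \<open>S\<close> of the lollipop and two vertices \<open>a \<le> b\<close> in it. Up to detours, the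
  only way from \<open>a\<close> to \<open>b\<close> is to jump inside the clique, if at all, and then to climb the tail one
  vertex at a time. So \<open>a\<close>
  and \<open>b\<close> are connected inside \<open>S\<close> exactly when \<open>S\<close> contains every \<open>v\<close> with \<open>a < v < b\<close> and
  \<open>m \<le> v\<close> (\<open>same_component_lollipop_iff\<close>): the label \<open>m\<close> counts as a tail vertex because it is the
  only gate between clique and tail.

  Apply this to \<open>S = w ` {1..j}\<close>, \<open>a = w j\<close>, and \<open>b = Max S\<close>. A missing \<open>v\<close> that separates
  \<open>a\<close> from \<open>b\<close> has the form \<open>v = w k\<close> with \<open>k > j\<close>, and \<open>b = w i\<close> with \<open>i < j\<close>; so \<open>w i\<close>,
  \<open>w j\<close>, \<open>w k\<close> form a forbidden pattern. Conversely the \<open>w k\<close> of a forbidden pattern is missing from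
  \<open>S\<close> and lies strictly between \<open>w j\<close> and \<open>w i \<le> Max S\<close>. Hence both sides of the equivalence
  assert the same thing for every \<open>j\<close>.
\<close>

lemma arcs_ends_induced_with_proj:
  "arcs_ends (with_proj G \<restriction> S) = {(u, v) \<in> parcs G. u \<in> S \<and> v \<in> S}"
  by (auto simp: arcs_ends_conv image_iff)

lemma (in sym_digraph) same_component_iff_reachable:
  "same_component G u v \<longleftrightarrow> u \<rightarrow>\<^sup>* v"
proof
  assume "same_component G u v"
  then show "u \<rightarrow>\<^sup>* v"
    by (auto simp: same_component_def in_sccs_verts_conv_reachable)
next
  assume uv: "u \<rightarrow>\<^sup>* v"
  then have "u \<in> verts G"
    by (rule reachable_in_verts)
  moreover have "v \<in> scc_of u"
    using uv symmetric_reachable' by (auto simp: scc_of_def)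
  ultimately show "same_component G u v"
    unfolding same_component_def using scc_of_in_sccs_verts in_scc_of_self by blast
qed

lemma sym_digraph_induced_lollipop:
  assumes "m \<ge> 1" "S \<subseteq> {1..m + n}"
  shows "sym_digraph (with_proj (lollipop m n) \<restriction> S)"
proof -
  interpret L: pair_graph "lollipop m n"
    using assms(1) by (rule pair_graph_lollipop)
  have "wf_digraph (with_proj (lollipop m n) \<restriction> S)"
    using assms(2) by (intro L.wellformed_induce_subgraph)
  moreover have "symmetric (with_proj (lollipop m n) \<restriction> S)"
    using L.pair_sym_arcs
    by (auto simp: symmetric_def sym_def arcs_ends_induced_with_proj)
  ultimately show ?thesis
    by (simp add: sym_digraph_def sym_digraph_axioms_def)
qed

text \<open>
  An upward arc whose target exceeds \<open>m\<close> is a tail arc and climbs by one only. So no arc jumps over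
  \<open>v\<close>, and a walk that starts below \<open>v\<close> and cannot use \<open>v\<close> stays below.
\<close>

lemma reachable_stays_below_missing:
  assumes "m \<ge> 1" "S \<subseteq> {1..m + n}"
    and "a \<rightarrow>\<^sup>*\<^bsub>with_proj (lollipop m n) \<restriction> S\<^esub> b"
    and "a < v" "m \<le> v" "v \<notin> S"
  shows "b < v"
proof -
  interpret H: sym_digraph "with_proj (lollipop m n) \<restriction> S"
    using assms(1,2) by (rule sym_digraph_induced_lollipop)
  from assms(3) show ?thesis
  proof (induction rule: H.reachable_induct)
    case base
    show ?case by fact
  next
    case (step x y)
    then have "(x, y) \<in> parcs (lollipop m n)" "y \<in> S"
      by (auto simp: arcs_ends_induced_with_proj)
    moreover from \<open>y \<in> S\<close> \<open>v \<notin> S\<close> have "y \<noteq> v"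
      by auto
    ultimately show ?case
      using \<open>x < v\<close> \<open>m \<le> v\<close> by (auto simp: lollipop_def)
  qed
qed

lemma reachable_along_tail:
  assumes "m \<ge> 1" "S \<subseteq> {1..m + n}"
    and "m \<le> a" "a \<le> b" "{a..b} \<subseteq> S"
  shows "a \<rightarrow>\<^sup>*\<^bsub>with_proj (lollipop m n) \<restriction> S\<^esub> b"
proof -
  interpret H: sym_digraph "with_proj (lollipop m n) \<restriction> S"
    using assms(1,2) by (rule sym_digraph_induced_lollipop)
  from \<open>a \<le> b\<close> \<open>{a..b} \<subseteq> S\<close> show ?thesis
  proof (induction b rule: dec_induct)
    case base
    then show ?case by auto
  next
    case (step k)
    then have "k \<in> S" "Suc k \<in> S"
      by auto
    with step.hyps assms(2,3)
    have "(k, Suc k) \<in> arcs_ends (with_proj (lollipop m n) \<restriction> S)"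
      by (auto simp: arcs_ends_induced_with_proj lollipop_def)
    moreover have "a \<rightarrow>\<^sup>*\<^bsub>with_proj (lollipop m n) \<restriction> S\<^esub> k"
    proof (rule step.IH)
      show "{a..k} \<subseteq> S"
        using step.prems by auto
    qed
    ultimately show ?case
      by (rule H.reachable_adj_trans[rotated])
  qed
qed

text \<open>
  A missing \<open>v\<close> is a barrier by the bound on what can be reached without it. If nothing is missing, walk from \<open>a\<close> to
  \<open>m\<close> by one clique arc (when \<open>a < m\<close>) and then along the tail; if \<open>b \<le> m\<close> a single clique arc
  suffices.
\<close>

lemma same_component_lollipop_iff:
  assumes "m \<ge> 1" "S \<subseteq> {1..m + n}"
    and "a \<in> S" "b \<in> S" "a \<le> b"
  shows "same_component (with_proj (lollipop m n) \<restriction> S) a b \<longleftrightarrow>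
           (\<forall>v. m \<le> v \<and> a < v \<and> v < b \<longrightarrow> v \<in> S)"
proof -
  interpret H: sym_digraph "with_proj (lollipop m n) \<restriction> S"
    using assms(1,2) by (rule sym_digraph_induced_lollipop)
  have clique: "x \<rightarrow>\<^sup>*\<^bsub>with_proj (lollipop m n) \<restriction> S\<^esub> y"
    if "x \<in> S" "y \<in> S" "x < y" "y \<le> m" for x y
  proof -
    have "1 \<le> x"
      using that assms(2) by auto
    then have "(x, y) \<in> arcs_ends (with_proj (lollipop m n) \<restriction> S)"
      using that by (auto simp: arcs_ends_induced_with_proj lollipop_def)
    then show ?thesis
      by (rule H.reachable_adjI)
  qed
  have "a \<rightarrow>\<^sup>*\<^bsub>with_proj (lollipop m n) \<restriction> S\<^esub> b"
    if full: "\<forall>v. m \<le> v \<and> a < v \<and> v < b \<longrightarrow> v \<in> S"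
  proof -
    have sub: "{max a m..b} \<subseteq> S"
    proof
      fix v
      assume "v \<in> {max a m..b}"
      then show "v \<in> S"
        using full assms(3,4) by (cases "v = a \<or> v = b") auto
    qed
    consider "a = b" | "m \<le> a" | "a < b" "b \<le> m" | "a < m" "m < b"
      using \<open>a \<le> b\<close> by linarith
    then show ?thesis
    proof cases
      case 1
      then show ?thesis using assms(3) by auto
    next
      case 2
      then show ?thesis
        using sub assms by (intro reachable_along_tail) auto
    next
      case 3
      then show ?thesis
        using clique assms(3,4) by blast
    next
      case 4
      then have "m \<in> S"
        using sub by auto
      with 4 have "a \<rightarrow>\<^sup>*\<^bsub>with_proj (lollipop m n) \<restriction> S\<^esub> m"
        using clique assms(3) by blast
      moreover have "m \<rightarrow>\<^sup>*\<^bsub>with_proj (lollipop m n) \<restriction> S\<^esub> b"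
        using 4 sub assms(1,2) by (intro reachable_along_tail) auto
      ultimately show ?thesis
        by (rule H.reachable_trans)
    qed
  qed
  moreover have "v \<in> S"
    if "a \<rightarrow>\<^sup>*\<^bsub>with_proj (lollipop m n) \<restriction> S\<^esub> b" "m \<le> v" "a < v" "v < b" for v
    using reachable_stays_below_missing[OF assms(1,2) that(1) that(3,2)] that(4) by auto
  ultimately show ?thesis
    unfolding H.same_component_iff_reachable by blast
qed

text \<open>
  A pattern whose smallest entry sits at position \<open>j\<close> is the same as a label \<open>v \<ge> m\<close> that exceeds
  \<open>w j\<close>, has not occurred up to position \<open>j\<close>, and is exceeded by a label that has. Only the largest
  of the labels seen so far matters for the last condition.
\<close>

lemma m312_free_iff_prefixes:
  assumes w: "w permutes {1..m + n}"
  shows "m312_free m n w \<longleftrightarrow>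
           (\<forall>j \<in> {1..m + n}. \<forall>v. m \<le> v \<and> w j < v \<and> v < Max (w ` {1..j}) \<longrightarrow> v \<in> w ` {1..j})"
    (is "_ \<longleftrightarrow> ?full")
proof
  assume free: "m312_free m n w"
  show ?full
  proof (intro ballI allI impI, rule ccontr)
    fix j v
    assume j: "j \<in> {1..m + n}"
      and v: "m \<le> v \<and> w j < v \<and> v < Max (w ` {1..j})"
      and missing: "v \<notin> w ` {1..j}"
    have "Max (w ` {1..j}) \<in> w ` {1..j}"
      using j by (intro Max_in) auto
    then obtain i where i: "i \<in> {1..j}" "Max (w ` {1..j}) = w i"
      by (rule imageE)
    have "i \<in> {1..m + n}"
      using i(1) j by simp
    then have "w i \<in> {1..m + n}"
      by (simp only: permutes_in_image[OF w])
    moreover have "w j < v" "v < w i" "m \<le> v"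
      using v unfolding i(2) by blast+
    ultimately have "v \<in> {1..m + n}"
      by simp
    then obtain k where k: "k \<in> {1..m + n}" "v = w k"
      using permutes_image[OF w] by blast
    have "i \<noteq> j"
      using \<open>w j < v\<close> \<open>v < w i\<close> by auto
    with i(1) have "i < j"
      by simp
    moreover have "j < k"
    proof (rule ccontr)
      assume "\<not> j < k"
      with k(1) have "k \<in> {1..j}"
        by simp
      with k(2) missing show False
        by blast
    qed
    ultimately show False
      using free i(1) k \<open>w j < v\<close> \<open>v < w i\<close> \<open>m \<le> v\<close>
      unfolding m312_free_def by auto
  qed
next
  assume full: ?full
  show "m312_free m n w"
    unfolding m312_free_def
  proof
    assume "\<exists>i j k. 1 \<le> i \<and> i < j \<and> j < k \<and> k \<le> m + n \<and> w j < w k \<and> w k < w i \<and> w k \<ge> m"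
    then obtain i j k where ijk: "1 \<le> i" "i < j" "j < k" "k \<le> m + n"
      "w j < w k" "w k < w i" "m \<le> w k"
      by blast
    have "w i \<le> Max (w ` {1..j})"
      using ijk by (intro Max_ge) auto
    with ijk(6) have "w k < Max (w ` {1..j})"
      by (rule less_le_trans)
    moreover have "j \<in> {1..m + n}"
      using ijk by simp
    ultimately have "w k \<in> w ` {1..j}"
      using full ijk(5,7) by blast
    then show False
      using \<open>j < k\<close> inj_image_mem_iff[OF permutes_inj[OF w]] by auto
  qed
qed

theorem proposition4p3:
  fixes m n :: nat and w :: "nat \<Rightarrow> nat"
  assumes "m \<ge> 1"
    and "w permutes {1..m + n}"
  shows "m312_free m n w \<longleftrightarrow> graph_permutation (lollipop m n) w"
proof -
  have "same_component (with_proj (lollipop m n) \<restriction> (w ` {1..j})) (w j) (Max (w ` {1..j})) \<longleftrightarrow>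
          (\<forall>v. m \<le> v \<and> w j < v \<and> v < Max (w ` {1..j}) \<longrightarrow> v \<in> w ` {1..j})"
    if j: "j \<in> {1..m + n}" for j
  proof (rule same_component_lollipop_iff)
    show "w ` {1..j} \<subseteq> {1..m + n}"
      using j permutes_image[OF assms(2)]
      by (metis atLeastAtMost_iff atLeastatMost_subset_iff image_mono le_refl)
    show "Max (w ` {1..j}) \<in> w ` {1..j}"
      using j by (intro Max_in) auto
  qed (use j assms(1) in auto)
  moreover have "pverts (lollipop m n) = {1..m + n}"
    by (simp add: lollipop_def)
  ultimately show ?thesis
    using assms(2) by (simp add: graph_permutation_def m312_free_iff_prefixes)
qed

end
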